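(* Let $\mathcal D\subseteq\mathcal S$, a finite audit bank $\mathcal U\subseteq\mathcal W$ with $|\mathcal U|=M$, a bank $W\subseteq\mathcal U$, $\delta>0$, $\eta\geq 0$, $N,R\in\mathbb N_{\ge1}$ and $\alpha\in(0,1)$ be fixed in advance. Let $s_1,\dots,s_N\in\mathcal D$ be an $\eta$-net of $\mathcal D$ under $d_{\mathcal U}$ (every $s\in\mathcal D$ has some $s_i$ with $d_{\mathcal U}(s,s_i)\le\eta$). For $1\le i\le N$, $u\in\mathcal U$, $1\le r\le R$, let $Y^{(r)}_{i,u}\in[0,1]$ be mutually independent random variables with mean $\phi_u(s_i)$. Then, with probability at least $1-\alpha$, $$\Omega^{\mathcal D}_{W\mid\mathcal U}(\delta)\ \ge\ \underline\Omega^{\mathcal D}_{W\mid\mathcal U}(\delta):=\widehat\Omega_{W\mid\mathcal U}(\delta)-2e_R-2\eta .$$ Consequently, with probability at least $1-\alpha$ the following holds: whenever $\tau,\xi\ge0$, a map $\psi_W:\mathcal H\to\mathbb R^{W}$ and a map $Q:\mathcal H\to\mathcal H$ satisfy $\lVert\psi_W(h)-\Phi_W(\pi(h))\rVert_\infty\le\tau$, $Q(h)\in\pi^{-1}(\mathcal D)$ and $\lVert\psi_W(Q(h))-\psi_W(h)\rVert_\infty\le\xi$ for all $h\in\pi^{-1}(\mathcal D)$, and $\xi+2\tau<\underline\Omega^{\mathcal D}_{W\mid\mathcal U}(\delta)$, then $d_{\mathcal U}(\pi(Q(h)),\pi(h))<\delta$ for all $h\in\pi^{-1}(\mathcal D)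$.
   Context: $\mathcal H\subseteq\mathbb R^d$ is a hidden-state domain; $\mathcal W$ is a set of tests with expected outcomes $\phi_w(h)\in[0,1]$. $h\sim h'$ iff $\phi_w(h)=\phi_w(h')$ for all $w\in\mathcal W$; $\mathcal S=\mathcal H/{\sim}$, $\pi:\mathcal H\to\mathcal S$ is the projection, and $\phi_w$ is regarded as a function on $\mathcal S$. For $V\subseteq\mathcal W$, $\Phi_V(s)=(\phi_w(s))_{w\in V}$; $d_{\mathcal U}(s,s')=\lVert\Phi_{\mathcal U}(s)-\Phi_{\mathcal U}(s')\rVert_\infty$, $d_W(s,s')=\lVert\Phi_W(s)-\Phi_W(s')\rVert_\infty$. The audited margin is $\Omega^{\mathcal D}_{W\mid\mathcal U}(\delta)=\inf\{d_W(s,s'):s,s'\in\mathcal D,\ d_{\mathcal U}(s,s')\ge\delta\}$ (infimum over the empty set is $+\infty$). Empirical quantities: $\widehat\phi_u(s_i)=R^{-1}\sum_{r=1}^RY^{(r)}_{i,u}$; $e_R=\sqrt{\log(2NM/\alpha)/(2R)}$; $\widehat d_{\mathcal U}(i,j)=\max_{u\in\mathcal U}|\widehat\phi_u(s_i)-\widehat\phi_u(s_j)|$; $\widehat d_W(i,j)=\max_{u\in W}|\widehat\phi_u(s_i)-\widehat\phi_u(s_j)|$; $\widehat{\mathcal A}_\delta=\{(i,j):\widehat d_{\mathcal U}(i,j)\ge\delta-2\eta-2e_R\}$; $\widehat\Omega_{W\mid\mathcal U}(\delta)=\min_{(i,j)\in\widehat{\mathcal A}_\delta}\widehat d_W(i,j)$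 (with the minimum over the empty set equal to $+\infty$). *)

theory Defs
  imports "HOL-Probability.Probability"
begin

text \<open>Throughout, \<open>T\<close> is the set of all tests, \<open>phi w h\<close> the expected outcome of test \<open>w\<close> in hidden
  state \<open>h\<close>, and \<open>U\<close>, \<open>V\<close>, \<open>W\<close> are banks, i.e. sets of tests.\<close>

definition test_equiv :: "'h set \<Rightarrow> 'w set \<Rightarrow> ('w \<Rightarrow> 'h \<Rightarrow> real) \<Rightarrow> ('h \<times> 'h) set" where
  "test_equiv H T phi = {(h, h'). h \<in> H \<and> h' \<in> H \<and> (\<forall>w\<in>T. phi w h = phi w h')}"

definition states :: "'h set \<Rightarrow> 'w set \<Rightarrow> ('w \<Rightarrow> 'h \<Rightarrow> real) \<Rightarrow> 'h set set" where
  "states H T phi = H // test_equiv H T phi"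

definition state_of :: "'h set \<Rightarrow> 'w set \<Rightarrow> ('w \<Rightarrow> 'h \<Rightarrow> real) \<Rightarrow> 'h \<Rightarrow> 'h set" where
  "state_of H T phi h = test_equiv H T phi `` {h}"

text \<open>For \<open>w \<in> T\<close> the map \<open>phi w\<close> is constant on every equivalence class \<open>s\<close>, so that
  \<open>phi w ` s\<close> is a singleton.\<close>

definition state_outcome :: "('w \<Rightarrow> 'h \<Rightarrow> real) \<Rightarrow> 'w \<Rightarrow> 'h set \<Rightarrow> real" where
  "state_outcome phi w s = the_elem (phi w ` s)"

definition outcome_vec :: "('w \<Rightarrow> 'h \<Rightarrow> real) \<Rightarrow> 'w set \<Rightarrow> 'h set \<Rightarrow> 'w \<Rightarrow> real" where
  "outcome_vec phi V s = (\<lambda>w\<in>V. state_outcome phi w s)"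

text \<open>The maximum norm on \<open>\<real>\<^sup>V\<close>; vectors are functions that are inspected on \<open>V\<close> only.
  Inserting \<open>0\<close> gives the norm on the trivial space the value \<open>0\<close> when \<open>V\<close> is empty, and changes
  nothing otherwise.\<close>

definition sup_norm :: "'w set \<Rightarrow> ('w \<Rightarrow> real) \<Rightarrow> real" where
  "sup_norm V x = Sup (insert 0 ((\<lambda>w. \<bar>x w\<bar>) ` V))"

definition bank_dist :: "('w \<Rightarrow> 'h \<Rightarrow> real) \<Rightarrow> 'w set \<Rightarrow> 'h set \<Rightarrow> 'h set \<Rightarrow> real" where
  "bank_dist phi V s s' = sup_norm V (\<lambda>w. outcome_vec phi V s w - outcome_vec phi V s' w)"

definition audited_margin ::
    "('w \<Rightarrow> 'h \<Rightarrow> real) \<Rightarrow> 'h set set \<Rightarrow> 'w set \<Rightarrow> 'w set \<Rightarrow> real \<Rightarrow> ereal" where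
  "audited_margin phi D W U \<delta> =
     Inf {ereal (bank_dist phi W s s') | s s'. s \<in> D \<and> s' \<in> D \<and> bank_dist phi U s s' \<ge> \<delta>}"

text \<open>In the empirical quantities, \<open>y i u r\<close> is the observed value of the \<open>r\<close>-th repetition of test
  \<open>u\<close> in the \<open>i\<close>-th net state, where \<open>i \<in> {1..N}\<close> and \<open>r \<in> {1..R}\<close>.\<close>

definition emp_outcome :: "nat \<Rightarrow> (nat \<Rightarrow> 'w \<Rightarrow> nat \<Rightarrow> real) \<Rightarrow> nat \<Rightarrow> 'w \<Rightarrow> real" where
  "emp_outcome R y i u = (\<Sum>r=1..R. y i u r) / real R"

definition conf_radius :: "nat \<Rightarrow> nat \<Rightarrow> real \<Rightarrow> nat \<Rightarrow> real" where
  "conf_radius N M \<alpha> R = sqrt (ln (2 * real N * real M / \<alpha>) / (2 * real R))"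

definition emp_dist :: "nat \<Rightarrow> (nat \<Rightarrow> 'w \<Rightarrow> nat \<Rightarrow> real) \<Rightarrow> 'w set \<Rightarrow> nat \<Rightarrow> nat \<Rightarrow> real" where
  "emp_dist R y V i j = sup_norm V (\<lambda>u. emp_outcome R y i u - emp_outcome R y j u)"

definition emp_pairs ::
    "nat \<Rightarrow> nat \<Rightarrow> real \<Rightarrow> real \<Rightarrow> (nat \<Rightarrow> 'w \<Rightarrow> nat \<Rightarrow> real) \<Rightarrow> 'w set \<Rightarrow> real \<Rightarrow> (nat \<times> nat) set" where
  "emp_pairs N R \<alpha> \<eta> y U \<delta> =
     {(i, j). i \<in> {1..N} \<and> j \<in> {1..N} \<and>
        emp_dist R y U i j \<ge> \<delta> - 2 * \<eta> - 2 * conf_radius N (card U) \<alpha> R}"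

definition emp_margin ::
    "nat \<Rightarrow> nat \<Rightarrow> real \<Rightarrow> real \<Rightarrow> (nat \<Rightarrow> 'w \<Rightarrow> nat \<Rightarrow> real) \<Rightarrow> 'w set \<Rightarrow> 'w set \<Rightarrow> real \<Rightarrow> ereal" where
  "emp_margin N R \<alpha> \<eta> y W U \<delta> =
     (if emp_pairs N R \<alpha> \<eta> y U \<delta> = {} then \<infinity>
      else Min ((\<lambda>(i, j). ereal (emp_dist R y W i j)) ` emp_pairs N R \<alpha> \<eta> y U \<delta>))"

definition margin_lower_bound ::
    "nat \<Rightarrow> nat \<Rightarrow> real \<Rightarrow> real \<Rightarrow> (nat \<Rightarrow> 'w \<Rightarrow> nat \<Rightarrow> real) \<Rightarrow> 'w set \<Rightarrow> 'w set \<Rightarrow> real \<Rightarrow> ereal" where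
  "margin_lower_bound N R \<alpha> \<eta> y W U \<delta> =
     emp_margin N R \<alpha> \<eta> y W U \<delta> - ereal (2 * conf_radius N (card U) \<alpha> R) - ereal (2 * \<eta>)"

end

theory Submission
  imports Defs
begin

text \<open>Hoeffding's inequality and a union bound over the \<open>N \<cdot> M\<close> pairs of a net state and a test
  show that, with probability at least \<open>1 - \<alpha>\<close>, all empirical means are within \<open>e\<^sub>R\<close> of the true ones.
  On this event empirical and true distances of net states differ by at most \<open>2 e\<^sub>R\<close>, and replacing
  two arbitrary states of \<open>D\<close> by net states costs at most \<open>2 \<eta>\<close> more; so every pair competing in
  the audited margin yields a pair competing in the empirical one. A violation of the conclusion
  on \<open>Q\<close> would give a pair at \<open>U\<close>-distance at least \<open>\<delta>\<close> whose \<open>W\<close>-distance is at most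
  \<open>\<xi> + 2 \<tau>\<close>, which contradicts the lower bound.\<close>

section \<open>The maximum norm on a finite bank\<close>

text \<open>Finiteness bounds the set under \<open>Sup\<close>; the conjunct
  \<open>0 \<le> c\<close> comes from the inserted \<open>0\<close> and matters only for empty
  \<open>V\<close>.\<close>

lemma sup_norm_le_iff:
  assumes "finite V"
  shows "sup_norm V x \<le> c \<longleftrightarrow> 0 \<le> c \<and> (\<forall>w\<in>V. \<bar>x w\<bar> \<le> c)"
proof -
  have "bdd_above (insert 0 ((\<lambda>w. \<bar>x w\<bar>) ` V))"
    using assms by simp
  then show ?thesis
    unfolding sup_norm_def by (subst cSup_le_iff) auto
qed

lemma sup_norm_nonneg: "finite V \<Longrightarrow> 0 \<le> sup_norm V x"
  using sup_norm_le_iff[of V x "sup_norm V x"] by simp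

lemma abs_le_sup_norm: "finite V \<Longrightarrow> w \<in> V \<Longrightarrow> \<bar>x w\<bar> \<le> sup_norm V x"
  using sup_norm_le_iff[of V x "sup_norm V x"] by simp

lemma sup_norm_mono:
  assumes "finite V" "W \<subseteq> V"
  shows "sup_norm W x \<le> sup_norm V x"
  using assms finite_subset[OF assms(2,1)]
  by (auto simp: sup_norm_le_iff sup_norm_nonneg abs_le_sup_norm)

lemma sup_norm_cong: "(\<And>w. w \<in> V \<Longrightarrow> x w = y w) \<Longrightarrow> sup_norm V x = sup_norm V y"
  unfolding sup_norm_def by (metis (mono_tags, lifting) image_cong)

lemma sup_norm_diff_commute:
  "sup_norm V (\<lambda>w. x w - y w) = sup_norm V (\<lambda>w. y w - x w)"
  unfolding sup_norm_def by (simp add: abs_minus_commute)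

lemma sup_norm_triangle:
  assumes "finite V"
  shows "sup_norm V (\<lambda>w. x w - z w) \<le> sup_norm V (\<lambda>w. x w - y w) + sup_norm V (\<lambda>w. y w - z w)"
proof -
  have "\<bar>x w - z w\<bar> \<le> sup_norm V (\<lambda>w. x w - y w) + sup_norm V (\<lambda>w. y w - z w)" if "w \<in> V" for w
    using abs_le_sup_norm[OF assms that, of "\<lambda>w. x w - y w"]
      abs_le_sup_norm[OF assms that, of "\<lambda>w. y w - z w"] by linarith
  then show ?thesis
    using assms by (auto simp: sup_norm_le_iff sup_norm_nonneg)
qed

text \<open>Passing from \<open>x\<close> to \<open>y\<close> through \<open>x'\<close> and
  \<open>y'\<close>, and likewise in the other direction, costs at most \<open>a + b\<close>. This
  serves every approximation below: states by net states, and outcome vectors by empirical or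
  represented ones.\<close>

lemma sup_norm_quadrangle:
  assumes "finite V"
    and "sup_norm V (\<lambda>w. x w - x' w) \<le> a" "sup_norm V (\<lambda>w. y w - y' w) \<le> b"
  shows "\<bar>sup_norm V (\<lambda>w. x w - y w) - sup_norm V (\<lambda>w. x' w - y' w)\<bar> \<le> a + b"
  using sup_norm_triangle[OF assms(1), of x y x'] sup_norm_triangle[OF assms(1), of x' y y']
    sup_norm_triangle[OF assms(1), of x' y' x] sup_norm_triangle[OF assms(1), of x y' y]
    sup_norm_diff_commute[of V x x'] sup_norm_diff_commute[of V y y'] assms(2,3)
  by linarith

lemma borel_measurable_sup_norm:
  assumes "finite V" "\<And>w. w \<in> V \<Longrightarrow> f w \<in> borel_measurable M"
  shows "(\<lambda>x. sup_norm V (\<lambda>w. f w x)) \<in> borel_measurable M"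
proof (subst borel_measurable_iff_le, intro allI)
  fix a
  have "{x \<in> space M. \<bar>f w x\<bar> \<le> a} \<in> sets M" if "w \<in> V" for w
  proof -
    note [measurable] = assms(2)[OF that]
    show ?thesis by measurable
  qed
  then have "{x \<in> space M. \<forall>w\<in>V. \<bar>f w x\<bar> \<le> a} \<in> sets M"
    using assms(1) by (rule sets.sets_Collect_finite_All)
  \<comment> \<open>For negative \<open>a\<close> the sublevel set is empty, as the norm is at least
    the inserted \<open>0\<close>; otherwise it is the finite intersection just shown
    measurable.\<close>
  then have "{x \<in> space M. 0 \<le> a \<and> (\<forall>w\<in>V. \<bar>f w x\<bar> \<le> a)} \<in> sets M"
    by (cases "0 \<le> a") simp_all
  then show "{x \<in> space M. sup_norm V (\<lambda>w. f w x) \<le> a} \<in> sets M"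
    unfolding sup_norm_le_iff[OF assms(1)] .
qed

section \<open>Distances between states and their empirical versions\<close>

lemma bank_dist_mono: "finite U \<Longrightarrow> W \<subseteq> U \<Longrightarrow> bank_dist phi W a b \<le> bank_dist phi U a b"
proof -
  assume *: "finite U" "W \<subseteq> U"
  \<comment> \<open>The outcome vectors for \<open>W\<close> and for \<open>U\<close> may differ off
    \<open>W\<close>, but the norm over \<open>W\<close> inspects only \<open>W\<close>, where they
    agree.\<close>
  have "bank_dist phi W a b = sup_norm W (\<lambda>w. outcome_vec phi U a w - outcome_vec phi U b w)"
    unfolding bank_dist_def by (rule sup_norm_cong) (use * in \<open>auto simp: outcome_vec_def\<close>)
  also have "\<dots> \<le> bank_dist phi U a b"
    unfolding bank_dist_def by (rule sup_norm_mono) (fact *)+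
  finally show ?thesis .
qed

lemma bank_dist_quadrangle:
  assumes "finite V" "bank_dist phi V a a' \<le> \<eta>" "bank_dist phi V b b' \<le> \<eta>"
  shows "\<bar>bank_dist phi V a b - bank_dist phi V a' b'\<bar> \<le> 2 * \<eta>"
  using sup_norm_quadrangle[OF assms(1)] assms(2,3) unfolding bank_dist_def by fastforce

lemma emp_dist_error:
  assumes "finite V" "0 \<le> e"
    and "\<And>u. u \<in> V \<Longrightarrow> \<bar>emp_outcome R y i u - state_outcome phi u (s i)\<bar> \<le> e"
    and "\<And>u. u \<in> V \<Longrightarrow> \<bar>emp_outcome R y j u - state_outcome phi u (s j)\<bar> \<le> e"
  shows "\<bar>emp_dist R y V i j - bank_dist phi V (s i) (s j)\<bar> \<le> 2 * e"
proof -
  have "sup_norm V (\<lambda>u. emp_outcome R y i u - outcome_vec phi V (s i) u) \<le> e"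
    "sup_norm V (\<lambda>u. emp_outcome R y j u - outcome_vec phi V (s j) u) \<le> e"
    using assms by (auto simp: sup_norm_le_iff outcome_vec_def)
  from sup_norm_quadrangle[OF assms(1) this] show ?thesis
    unfolding emp_dist_def bank_dist_def by simp
qed

section \<open>The empirical margin and the confidence radius\<close>

lemma finite_emp_pairs: "finite (emp_pairs N R \<alpha> \<eta> y U \<delta>)"
  by (rule finite_subset[of _ "{1..N} \<times> {1..N}"]) (auto simp: emp_pairs_def)

text \<open>The set of pairs competing in the empirical margin depends on the sample. Giving all
  other pairs the value \<open>\<infinity>\<close> yields an infimum over a fixed finite index set,
  the form used to prove measurability.\<close>

lemma emp_margin_eq_INF:
  "emp_margin N R \<alpha> \<eta> y W U \<delta> = (INF p\<in>{1..N} \<times> {1..N}.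
     if emp_dist R y U (fst p) (snd p) \<ge> \<delta> - 2 * \<eta> - 2 * conf_radius N (card U) \<alpha> R
     then ereal (emp_dist R y W (fst p) (snd p)) else \<infinity>)"
    (is "_ = (INF p\<in>?N. ?f p)")
proof -
  let ?P = "emp_pairs N R \<alpha> \<eta> y U \<delta>"
  have f: "?f p = (if p \<in> ?P then (case p of (i, j) \<Rightarrow> ereal (emp_dist R y W i j)) else \<infinity>)"
    if "p \<in> ?N" for p
    using that by (auto simp: emp_pairs_def)
  have sub: "?P \<subseteq> ?N"
    by (auto simp: emp_pairs_def)
  have "(INF p\<in>?N. ?f p) = (INF p\<in>?P. case p of (i, j) \<Rightarrow> ereal (emp_dist R y W i j))"
  proof (rule antisym)
    show "(INF p\<in>?N. ?f p) \<le> (INF p\<in>?P. case p of (i, j) \<Rightarrow> ereal (emp_dist R y W i j))"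
    proof (rule INF_greatest)
      fix p assume p: "p \<in> ?P"
      then have "?f p = (case p of (i, j) \<Rightarrow> ereal (emp_dist R y W i j))"
        using f[of p] sub by auto
      then show "(INF p\<in>?N. ?f p) \<le> (case p of (i, j) \<Rightarrow> ereal (emp_dist R y W i j))"
        using p sub INF_lower[of p ?N ?f] by auto
    qed
    show "(INF p\<in>?P. case p of (i, j) \<Rightarrow> ereal (emp_dist R y W i j)) \<le> (INF p\<in>?N. ?f p)"
      by (rule INF_greatest) (subst f, auto intro: INF_lower2)
  qed
  also have "\<dots> = emp_margin N R \<alpha> \<eta> y W U \<delta>"
  proof (cases "?P = {}")
    case True
    then show ?thesis by (simp add: emp_margin_def top_ereal_def)
  next
    case False
    then show ?thesis
      unfolding emp_margin_def using finite_emp_pairs[of N R \<alpha> \<eta> y U \<delta>]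
      by (simp add: Min_Inf)
  qed
  finally show ?thesis ..
qed

lemma emp_margin_le:
  assumes "(i, j) \<in> emp_pairs N R \<alpha> \<eta> y U \<delta>"
  shows "emp_margin N R \<alpha> \<eta> y W U \<delta> \<le> ereal (emp_dist R y W i j)"
  unfolding emp_margin_def using assms finite_emp_pairs[of N R \<alpha> \<eta> y U \<delta>]
  by (auto intro!: Min_le)

text \<open>An empty bank has radius \<open>0\<close> by the convention \<open>ln 0 = 0\<close>, so it needs no separate treatment.\<close>

lemma conf_radius_nonneg:
  assumes "0 < \<alpha>" "\<alpha> < 1"
  shows "0 \<le> conf_radius N M \<alpha> R"
proof (cases "N = 0 \<or> M = 0")
  case True
  then show ?thesis by (auto simp: conf_radius_def)
next
  case False
  then have "1 \<le> N * M" by (simp add: Suc_le_eq)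
  then have "1 \<le> real N * real M"
    by (metis of_nat_1 of_nat_le_iff of_nat_mult)
  then have "1 \<le> 2 * real N * real M / \<alpha>"
    using assms by (simp add: field_simps)
  then show ?thesis by (simp add: conf_radius_def)
qed

text \<open>The radius is chosen to solve this equation: the two-sided Hoeffding bound for a mean of
  \<open>R\<close> values in the unit interval becomes an equal share of \<open>\<alpha>\<close> for
  each of the \<open>N * M\<close> pairs.\<close>

lemma exp_conf_radius:
  assumes "0 < \<alpha>" "\<alpha> < 1" "1 \<le> N" "1 \<le> M" "1 \<le> R"
  shows "2 * exp (- 2 * real R * (conf_radius N M \<alpha> R)\<^sup>2) = \<alpha> / (real N * real M)"
proof -
  let ?x = "2 * real N * real M / \<alpha>"
  have "1 \<le> N * M" using assms by (simp add: Suc_le_eq)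
  then have "1 \<le> real N * real M"
    by (metis of_nat_1 of_nat_le_iff of_nat_mult)
  \<comment> \<open>This makes \<open>ln ?x\<close> nonnegative, so that squaring undoes the square
    root.\<close>
  then have x: "1 \<le> ?x"
    using assms by (simp add: field_simps)
  then have "(conf_radius N M \<alpha> R)\<^sup>2 = ln ?x / (2 * real R)"
    unfolding conf_radius_def by simp
  then have "exp (- 2 * real R * (conf_radius N M \<alpha> R)\<^sup>2) = exp (- ln ?x)"
    using assms by simp
  also have "\<dots> = inverse ?x"
    using x by (simp add: exp_minus)
  finally show ?thesis
    by simp
qed

section \<open>The deterministic argument\<close>

lemma margin_lower_bound_le:
  assumes U: "finite U" "W \<subseteq> U" and \<alpha>: "0 < \<alpha>" "\<alpha> < 1"
    and net: "\<And>t. t \<in> D \<Longrightarrow> \<exists>i\<in>{1..N}. bank_dist phi U t (s i) \<le> \<eta>"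
    and acc: "\<And>i u. i \<in> {1..N} \<Longrightarrow> u \<in> U \<Longrightarrow>
      \<bar>emp_outcome R y i u - state_outcome phi u (s i)\<bar> \<le> conf_radius N (card U) \<alpha> R"
  shows "margin_lower_bound N R \<alpha> \<eta> y W U \<delta> \<le> audited_margin phi D W U \<delta>"
  unfolding audited_margin_def
proof (rule Inf_greatest, clarify)
  fix a b assume ab: "a \<in> D" "b \<in> D" "\<delta> \<le> bank_dist phi U a b"
  let ?e = "conf_radius N (card U) \<alpha> R"
  obtain i j where i: "i \<in> {1..N}" "bank_dist phi U a (s i) \<le> \<eta>"
    and j: "j \<in> {1..N}" "bank_dist phi U b (s j) \<le> \<eta>"
    using net ab by meson
  have W: "finite W" using U finite_subset by auto
  have e: "0 \<le> ?e" using conf_radius_nonneg[OF \<alpha>] .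
  have "\<bar>emp_dist R y U i j - bank_dist phi U (s i) (s j)\<bar> \<le> 2 * ?e"
    by (rule emp_dist_error) (use U e acc i j in auto)
  moreover have "\<bar>bank_dist phi U a b - bank_dist phi U (s i) (s j)\<bar> \<le> 2 * \<eta>"
    by (rule bank_dist_quadrangle) (use U i j in auto)
  \<comment> \<open>The slack \<open>2 * \<eta> + 2 * ?e\<close> in the threshold of
    \<open>emp_pairs\<close> is exactly the sum of these two errors.\<close>
  ultimately have "(i, j) \<in> emp_pairs N R \<alpha> \<eta> y U \<delta>"
    using ab i j unfolding emp_pairs_def by auto
  then have "emp_margin N R \<alpha> \<eta> y W U \<delta> \<le> ereal (emp_dist R y W i j)"
    by (rule emp_margin_le)
  then have "margin_lower_bound N R \<alpha> \<eta> y W U \<delta>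
      \<le> ereal (emp_dist R y W i j) - ereal (2 * ?e) - ereal (2 * \<eta>)"
    unfolding margin_lower_bound_def by (intro ereal_minus_mono order_refl)
  also have "\<dots> = ereal (emp_dist R y W i j - 2 * ?e - 2 * \<eta>)"
    by simp
  also have "\<dots> \<le> ereal (bank_dist phi W a b)"
  proof -
    have "\<bar>emp_dist R y W i j - bank_dist phi W (s i) (s j)\<bar> \<le> 2 * ?e"
      by (rule emp_dist_error) (use U W e acc i j in auto)
    \<comment> \<open>The net is \<open>\<eta>\<close>-fine in the \<open>U\<close>-distance, which
      dominates the \<open>W\<close>-distance.\<close>
    moreover have "\<bar>bank_dist phi W a b - bank_dist phi W (s i) (s j)\<bar> \<le> 2 * \<eta>"
      using bank_dist_mono[OF U, of phi a "s i"] bank_dist_mono[OF U, of phi b "s j"] i j W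
      by (intro bank_dist_quadrangle) auto
    ultimately show ?thesis by simp
  qed
  finally show "margin_lower_bound N R \<alpha> \<eta> y W U \<delta> \<le> ereal (bank_dist phi W a b)" .
qed

text \<open>Meant for \<open>a\<close> the state of \<open>Q h\<close> and \<open>b\<close> that of
  \<open>h\<close>, with \<open>x\<close> and \<open>z\<close> their representations
  \<open>\<psi> (Q h)\<close> and \<open>\<psi> h\<close>. As these err by at most
  \<open>\<tau>\<close>, the states have \<open>W\<close>-distance at most
  \<open>\<xi> + 2 * \<tau>\<close>, too little for a pair competing in the margin.\<close>

lemma margin_transfer:
  assumes W: "finite W"
    and L: "L \<le> audited_margin phi D W U \<delta>" "ereal (\<xi> + 2 * \<tau>) < L"
    and D: "a \<in> D" "b \<in> D"
    and a: "sup_norm W (\<lambda>w. x w - outcome_vec phi W a w) \<le> \<tau>"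
    and b: "sup_norm W (\<lambda>w. z w - outcome_vec phi W b w) \<le> \<tau>"
    and xz: "sup_norm W (\<lambda>w. x w - z w) \<le> \<xi>"
  shows "bank_dist phi U a b < \<delta>"
proof (rule ccontr)
  assume "\<not> bank_dist phi U a b < \<delta>"
  then have "audited_margin phi D W U \<delta> \<le> ereal (bank_dist phi W a b)"
    unfolding audited_margin_def using D
    by (intro Inf_lower CollectI exI[of _ a] exI[of _ b] conjI) auto
  also have "bank_dist phi W a b \<le> \<xi> + 2 * \<tau>"
    using sup_norm_quadrangle[OF W a b] xz unfolding bank_dist_def by linarith
  finally show False
    using L by (meson ereal_less_eq(3) leD order_trans)
qed

section \<open>Concentration of the empirical means\<close>

context prob_space
begin

text \<open>With \<open>n = card I\<close>, this is Hoeffding's inequality for the sum at deviation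
  \<open>n * \<epsilon>\<close>: the \<open>n\<close> unit intervals put \<open>n\<close> into the
  denominator of the exponent, which leaves \<open>- 2 * n * \<epsilon>\<^sup>2\<close>.\<close>

lemma Hoeffding_mean_abs_ge:
  assumes "finite I" "I \<noteq> {}" "indep_vars (\<lambda>_. borel) X I"
    and "\<And>i x. i \<in> I \<Longrightarrow> x \<in> space M \<Longrightarrow> X i x \<in> {0..1}"
    and "\<And>i. i \<in> I \<Longrightarrow> expectation (X i) = m"
    and "0 \<le> \<epsilon>"
  shows "prob {x \<in> space M. \<bar>(\<Sum>i\<in>I. X i x) / real (card I) - m\<bar> \<ge> \<epsilon>}
           \<le> 2 * exp (- 2 * real (card I) * \<epsilon>\<^sup>2)"
proof -
  let ?n = "real (card I)"
  have n: "?n > 0" using assms(1,2) by (simp add: card_gt_0_iff)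
  interpret Hoeffding_ineq M I X "\<lambda>_. 0" "\<lambda>_. 1" "\<Sum>i\<in>I. expectation (X i)"
    by unfold_locales (use assms in auto)
  have "\<bar>S / ?n - m\<bar> \<ge> \<epsilon> \<longleftrightarrow> \<bar>S - ?n * m\<bar> \<ge> ?n * \<epsilon>" for S
  proof -
    have "S / ?n - m = (S - ?n * m) / ?n"
      using n by (simp add: field_simps)
    then have "\<bar>S / ?n - m\<bar> = \<bar>S - ?n * m\<bar> / ?n"
      by simp
    then show ?thesis using n by (simp add: field_simps)
  qed
  moreover have "(\<Sum>i\<in>I. expectation (X i)) = ?n * m"
    using assms(5) by simp
  ultimately have "prob {x \<in> space M. \<bar>(\<Sum>i\<in>I. X i x) / ?n - m\<bar> \<ge> \<epsilon>}
      \<le> 2 * exp (- 2 * (?n * \<epsilon>)\<^sup>2 / ?n)"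
    using Hoeffding_ineq_abs_ge[of "?n * \<epsilon>"] n assms(6) by simp
  also have "- 2 * (?n * \<epsilon>)\<^sup>2 / ?n = - 2 * ?n * \<epsilon>\<^sup>2"
    using n by (simp add: power2_eq_square)
  finally show ?thesis .
qed

text \<open>\<open>G\<close> is the complement of the union of the \<open>N * card U\<close> bad
  events, each of probability at most its share of \<open>\<alpha>\<close>.\<close>

lemma prob_all_emp_outcomes_accurate:
  assumes "finite U" "1 \<le> N" "1 \<le> R" "0 < \<alpha>" "\<alpha> < 1"
    and indep: "indep_vars (\<lambda>_. borel) (\<lambda>(i, u, r). Y i u r) ({1..N} \<times> U \<times> {1..R})"
    and range: "\<And>i u r x. i \<in> {1..N} \<Longrightarrow> u \<in> U \<Longrightarrow> r \<in> {1..R} \<Longrightarrow> x \<in> space M \<Longrightarrow>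
      Y i u r x \<in> {0..1}"
    and mean: "\<And>i u r. i \<in> {1..N} \<Longrightarrow> u \<in> U \<Longrightarrow> r \<in> {1..R} \<Longrightarrow> expectation (Y i u r) = m i u"
    and meas: "\<And>i u. i \<in> {1..N} \<Longrightarrow> u \<in> U \<Longrightarrow>
      (\<lambda>x. emp_outcome R (\<lambda>i u r. Y i u r x) i u) \<in> borel_measurable M"
  shows "\<exists>G\<in>sets M. 1 - \<alpha> \<le> prob G \<and> (\<forall>x\<in>G. \<forall>i\<in>{1..N}. \<forall>u\<in>U.
    \<bar>emp_outcome R (\<lambda>i u r. Y i u r x) i u - m i u\<bar> \<le> conf_radius N (card U) \<alpha> R)"
proof -
  let ?e = "conf_radius N (card U) \<alpha> R"
  define B where "B = (\<lambda>(i, u). {x \<in> space M.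
    \<bar>emp_outcome R (\<lambda>i u r. Y i u r x) i u - m i u\<bar> \<ge> ?e})"
  have B_sets: "B p \<in> sets M" if "p \<in> {1..N} \<times> U" for p
  proof -
    obtain i u where p: "p = (i, u)" "i \<in> {1..N}" "u \<in> U" using \<open>p \<in> _\<close> by auto
    note [measurable] = meas[OF p(2,3)]
    show ?thesis unfolding B_def p(1) prod.case by measurable
  qed
  have B_prob: "prob (B p) \<le> \<alpha> / (real N * real (card U))" if "p \<in> {1..N} \<times> U" for p
  proof -
    obtain i u where p: "p = (i, u)" "i \<in> {1..N}" "u \<in> U" using \<open>p \<in> _\<close> by auto
    \<comment> \<open>Keeping full index triples lets independence pass from the whole family to the
      repetitions of one pair by restriction to a subset.\<close>
    let ?I = "{i} \<times> {u} \<times> {1..R}"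
    let ?X = "\<lambda>(i, u, r). Y i u r"
    \<comment> \<open>The existence of \<open>u\<close> rules out the empty bank, which
      \<open>exp_conf_radius\<close> does not cover.\<close>
    have "1 \<le> card U" using p(3) assms(1) by (auto simp: Suc_le_eq card_gt_0_iff)
    have sum: "(\<Sum>q\<in>?I. ?X q x) = (\<Sum>r=1..R. Y i u r x)" for x
    proof -
      have "?I = (\<lambda>r. (i, u, r)) ` {1..R}" by auto
      then show ?thesis by (simp add: sum.reindex inj_on_def)
    qed
    have "prob {x \<in> space M. \<bar>(\<Sum>q\<in>?I. ?X q x) / real (card ?I) - m i u\<bar> \<ge> ?e}
        \<le> 2 * exp (- 2 * real (card ?I) * ?e\<^sup>2)"
    proof (rule Hoeffding_mean_abs_ge)
      show "indep_vars (\<lambda>_. borel) ?X ?I"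
        by (rule indep_vars_subset[OF indep]) (use p in auto)
    qed (use p assms range mean conf_radius_nonneg in auto)
    then have "prob (B p) \<le> 2 * exp (- 2 * real R * ?e\<^sup>2)"
      unfolding B_def p(1) sum prod.case emp_outcome_def by (simp add: card_cartesian_product)
    also have "\<dots> = \<alpha> / (real N * real (card U))"
      using assms \<open>1 \<le> card U\<close> by (intro exp_conf_radius) auto
    finally show ?thesis .
  qed
  have fin: "finite ({1..N} \<times> U)" using assms(1) by simp
  let ?A = "\<Union>p\<in>{1..N} \<times> U. B p"
  have A: "?A \<in> sets M" using fin B_sets by (intro sets.finite_UN) auto
  have "prob ?A \<le> (\<Sum>p\<in>{1..N} \<times> U. prob (B p))"
    using fin B_sets by (intro finite_measure_subadditive_finite) auto
  also have "\<dots> \<le> (\<Sum>p\<in>{1..N} \<times> U. \<alpha> / (real N * real (card U)))"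
    by (intro sum_mono B_prob)
  \<comment> \<open>Equality holds unless \<open>U\<close> is empty, when the sum is
    \<open>0\<close>.\<close>
  also have "\<dots> \<le> \<alpha>"
    using assms(2,4) by (simp add: card_cartesian_product)
  finally have "1 - \<alpha> \<le> prob (space M - ?A)"
    using A by (simp add: prob_compl)
  moreover have "\<bar>emp_outcome R (\<lambda>i u r. Y i u r x) i u - m i u\<bar> \<le> ?e"
    if "x \<in> space M - ?A" "i \<in> {1..N}" "u \<in> U" for x i u
    using that unfolding B_def by fastforce
  ultimately show ?thesis
    using A by (intro bexI[of _ "space M - ?A"]) auto
qed

end

section \<open>Measurability and the two probability bounds\<close>

text \<open>The bound depends on the sample only through the empirical means on \<open>U\<close>,
  and finite norms and infima over a fixed index set preserve measurability. This matters because
  \<open>prob\<close> is \<open>0\<close> on nonmeasurable sets, so including \<open>G\<close> alone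
  would bound nothing.\<close>

lemma borel_measurable_margin_lower_bound:
  assumes U: "finite U" "W \<subseteq> U"
    and meas: "\<And>i u. i \<in> {1..N} \<Longrightarrow> u \<in> U \<Longrightarrow>
      (\<lambda>x. emp_outcome R (y x) i u) \<in> borel_measurable M"
  shows "(\<lambda>x. margin_lower_bound N R \<alpha> \<eta> (y x) W U \<delta>) \<in> borel_measurable M"
proof -
  have dist: "(\<lambda>x. emp_dist R (y x) V (fst p) (snd p)) \<in> borel_measurable M"
    if "V \<subseteq> U" "p \<in> {1..N} \<times> {1..N}" for V p
    unfolding emp_dist_def
    by (rule borel_measurable_sup_norm)
      (use that U finite_subset meas in \<open>auto intro!: borel_measurable_diff\<close>)
  have "(\<lambda>x. emp_margin N R \<alpha> \<eta> (y x) W U \<delta>) \<in> borel_measurable M"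
    unfolding emp_margin_eq_INF
  proof (rule borel_measurable_INF)
    fix p assume p: "p \<in> {1..N} \<times> {1..N}"
    note [measurable] = dist[OF U(2) p] dist[OF order_refl p]
    show "(\<lambda>x. if \<delta> - 2 * \<eta> - 2 * conf_radius N (card U) \<alpha> R \<le> emp_dist R (y x) U (fst p) (snd p)
        then ereal (emp_dist R (y x) W (fst p) (snd p)) else \<infinity>) \<in> borel_measurable M"
      by measurable
  qed simp
  then show ?thesis
    unfolding margin_lower_bound_def by measurable
qed

text \<open>The second event quantifies over uncountably many maps; it is measurable since it
  depends on the sample only through the comparison of one random variable with constants.\<close>

lemma sets_Collect_all_less_imp:
  fixes f :: "'a \<Rightarrow> ereal"
  assumes [measurable]: "f \<in> borel_measurable M"
  shows "{x \<in> space M. \<forall>c\<in>C. \<not> c < f x} \<in> sets M"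
proof -
  have "{x \<in> space M. \<forall>c\<in>C. \<not> c < f x} = {x \<in> space M. f x \<le> Inf C}"
    by (auto simp: le_Inf_iff not_less)
  then show ?thesis by simp
qed

theorem theorem8:
  fixes H :: "(real ^ 'd) set" and T U W :: "'w set"
    and phi :: "'w \<Rightarrow> real ^ 'd \<Rightarrow> real"
    and D :: "(real ^ 'd) set set"
    and \<delta> \<eta> \<alpha> :: real and N R :: nat
    and s :: "nat \<Rightarrow> (real ^ 'd) set"
    and P :: "'p measure" and Y :: "nat \<Rightarrow> 'w \<Rightarrow> nat \<Rightarrow> 'p \<Rightarrow> real"
  assumes phi_range: "\<And>w h. w \<in> T \<Longrightarrow> h \<in> H \<Longrightarrow> phi w h \<in> {0..1}"
    and D: "D \<subseteq> states H T phi"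
    and U: "finite U" "U \<subseteq> T"
    and W: "W \<subseteq> U"
    and params: "\<delta> > 0" "\<eta> \<ge> 0" "N \<ge> 1" "R \<ge> 1" "0 < \<alpha>" "\<alpha> < 1"
    and net_in: "\<And>i. i \<in> {1..N} \<Longrightarrow> s i \<in> D"
    and net: "\<And>t. t \<in> D \<Longrightarrow> \<exists>i\<in>{1..N}. bank_dist phi U t (s i) \<le> \<eta>"
    and P: "prob_space P"
    and Y_indep: "prob_space.indep_vars P (\<lambda>_. borel) (\<lambda>(i, u, r). Y i u r) ({1..N} \<times> U \<times> {1..R})"
    and Y_range: "\<And>i u r x. i \<in> {1..N} \<Longrightarrow> u \<in> U \<Longrightarrow> r \<in> {1..R} \<Longrightarrow> x \<in> space P \<Longrightarrow> Y i u r x \<in> {0..1}"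
    and Y_mean: "\<And>i u r. i \<in> {1..N} \<Longrightarrow> u \<in> U \<Longrightarrow> r \<in> {1..R} \<Longrightarrow>
                   prob_space.expectation P (Y i u r) = state_outcome phi u (s i)"
  shows "prob_space.prob P {x \<in> space P.
            audited_margin phi D W U \<delta> \<ge> margin_lower_bound N R \<alpha> \<eta> (\<lambda>i u r. Y i u r x) W U \<delta>}
          \<ge> 1 - \<alpha>
       \<and> prob_space.prob P {x \<in> space P.
            \<forall>(\<tau>::real) (\<xi>::real) (\<psi> :: real ^ 'd \<Rightarrow> 'w \<Rightarrow> real) (Q :: real ^ 'd \<Rightarrow> real ^ 'd).
              \<tau> \<ge> 0 \<longrightarrow> \<xi> \<ge> 0 \<longrightarrow> Q \<in> H \<rightarrow> H \<longrightarrow>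
              (\<forall>h \<in> {h \<in> H. state_of H T phi h \<in> D}.
                 sup_norm W (\<lambda>w. \<psi> h w - outcome_vec phi W (state_of H T phi h) w) \<le> \<tau> \<and>
                 Q h \<in> {h \<in> H. state_of H T phi h \<in> D} \<and>
                 sup_norm W (\<lambda>w. \<psi> (Q h) w - \<psi> h w) \<le> \<xi>) \<longrightarrow>
              ereal (\<xi> + 2 * \<tau>) < margin_lower_bound N R \<alpha> \<eta> (\<lambda>i u r. Y i u r x) W U \<delta> \<longrightarrow>
              (\<forall>h \<in> {h \<in> H. state_of H T phi h \<in> D}.
                 bank_dist phi U (state_of H T phi (Q h)) (state_of H T phi h) < \<delta>)}
          \<ge> 1 - \<alpha>"
proof -
  interpret prob_space P by (rule P)
  let ?H = "{h \<in> H. state_of H T phi h \<in> D}"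
  let ?p = "state_of H T phi"
  let ?m = "audited_margin phi D W U \<delta>"
  define L where "L = (\<lambda>x. margin_lower_bound N R \<alpha> \<eta> (\<lambda>i u r. Y i u r x) W U \<delta>)"
  define adm where "adm = (\<lambda>(\<tau>::real) (\<xi>::real) (\<psi> :: real ^ 'd \<Rightarrow> 'w \<Rightarrow> real)
      (Q :: real ^ 'd \<Rightarrow> real ^ 'd). \<tau> \<ge> 0 \<and> \<xi> \<ge> 0 \<and> Q \<in> H \<rightarrow> H \<and>
      (\<forall>h \<in> ?H. sup_norm W (\<lambda>w. \<psi> h w - outcome_vec phi W (?p h) w) \<le> \<tau> \<and>
         Q h \<in> ?H \<and> sup_norm W (\<lambda>w. \<psi> (Q h) w - \<psi> h w) \<le> \<xi>))"
  define close where
    "close = (\<lambda>Q. \<forall>h \<in> ?H. bank_dist phi U (?p (Q h)) (?p h) < \<delta>)"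
  \<comment> \<open>These are the values of \<open>\<xi> + 2 * \<tau>\<close> for admissible data
    that violate the conclusion. The second event says that none of them lies below
    \<open>L x\<close>; the maps are thus absorbed into a set independent of
    \<open>x\<close>.\<close>
  let ?C = "{ereal (\<xi> + 2 * \<tau>) | \<tau> \<xi>. \<exists>\<psi> Q. adm \<tau> \<xi> \<psi> Q \<and> \<not> close Q}"
  let ?E1 = "{x \<in> space P. L x \<le> ?m}"
  let ?E2 = "{x \<in> space P. \<forall>c\<in>?C. \<not> c < L x}"
  have "finite W" using U(1) W finite_subset by auto
  have emp: "(\<lambda>x. emp_outcome R (\<lambda>i u r. Y i u r x) i u) \<in> borel_measurable P"
    if "i \<in> {1..N}" "u \<in> U" for i u
  proof -
    have "Y i u r \<in> borel_measurable P" if "r \<in> {1..R}" for r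
      using Y_indep \<open>i \<in> _\<close> \<open>u \<in> _\<close> that unfolding indep_vars_def by fastforce
    then show ?thesis
      unfolding emp_outcome_def by (intro borel_measurable_divide borel_measurable_sum) auto
  qed
  have L: "L \<in> borel_measurable P"
    unfolding L_def by (rule borel_measurable_margin_lower_bound[OF U(1) W emp])
  then have E1: "?E1 \<in> sets P" by measurable
  obtain G where G_sets: "G \<in> sets P"
    and G: "1 - \<alpha> \<le> prob G \<and> (\<forall>x\<in>G. \<forall>i\<in>{1..N}. \<forall>u\<in>U.
      \<bar>emp_outcome R (\<lambda>i u r. Y i u r x) i u - state_outcome phi u (s i)\<bar>
        \<le> conf_radius N (card U) \<alpha> R)"
    by (rule bexE[OF prob_all_emp_outcomes_accurate
          [OF U(1) params(3-6) Y_indep Y_range Y_mean emp]])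
  have "G \<subseteq> ?E1"
  proof
    fix x assume x: "x \<in> G"
    note acc = G[THEN conjunct2, THEN bspec, OF x, THEN bspec, THEN bspec]
    have "L x \<le> ?m"
      unfolding L_def
      by (rule margin_lower_bound_le[OF U(1) W params(5,6) net acc])
    then show "x \<in> ?E1" using x sets.sets_into_space[OF G_sets] by auto
  qed
  then have prob1: "1 - \<alpha> \<le> prob ?E1"
    using E1 by (intro order_trans[OF G[THEN conjunct1] finite_measure_mono])
  \<comment> \<open>The single inequality \<open>L x \<le> ?m\<close> serves all maps at once, so
    the second event costs no further probability.\<close>
  have close: "close Q" if "L x \<le> ?m" "ereal (\<xi> + 2 * \<tau>) < L x" "adm \<tau> \<xi> \<psi> Q" for x \<tau> \<xi> \<psi> Q
    unfolding close_def
  proof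
    fix h assume h: "h \<in> ?H"
    have adm: "sup_norm W (\<lambda>w. \<psi> h w - outcome_vec phi W (?p h) w) \<le> \<tau>"
      "Q h \<in> ?H" "sup_norm W (\<lambda>w. \<psi> (Q h) w - \<psi> h w) \<le> \<xi>" if "h \<in> ?H" for h
      using \<open>adm \<tau> \<xi> \<psi> Q\<close> that unfolding adm_def by simp_all
    \<comment> \<open>Accuracy of \<open>\<psi>\<close> is used at \<open>h\<close> and also at
      \<open>Q h\<close>, which lies in \<open>?H\<close> again.\<close>
    show "bank_dist phi U (?p (Q h)) (?p h) < \<delta>"
      using adm(2)[OF h] h
      by (intro margin_transfer[OF \<open>finite W\<close> that(1,2) _ _ adm(1)[OF adm(2)[OF h]] adm(1,3)[OF h]]) auto
  qed
  then have "?E1 \<subseteq> ?E2"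
    by auto
  then have "1 - \<alpha> \<le> prob ?E2"
    by (intro order_trans[OF prob1 finite_measure_mono] sets_Collect_all_less_imp L)
  also have "?E2 = {x \<in> space P. \<forall>\<tau> \<xi> \<psi> Q. adm \<tau> \<xi> \<psi> Q \<longrightarrow> ereal (\<xi> + 2 * \<tau>) < L x \<longrightarrow> close Q}"
    by blast
  finally have prob2: "1 - \<alpha> \<le> prob {x \<in> space P. \<forall>\<tau> \<xi> \<psi> Q. adm \<tau> \<xi> \<psi> Q \<longrightarrow>
      ereal (\<xi> + 2 * \<tau>) < L x \<longrightarrow> close Q}" .
  \<comment> \<open>\<open>imp_conjL\<close> turns the conjunction bundled in \<open>adm\<close>
    into the chain of implications of the statement.\<close>
  show ?thesis
    by (rule conjI[OF prob1[unfolded L_def] prob2[unfolded L_def adm_def close_def imp_conjL]])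
qed

end
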